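(* Let $\theta=(\theta_1,\theta_2)\in\mathbb{R}^2$ with irrationality measure function $\Psi$, let $m>2$ be an integer, and suppose there is a constant $C_2>0$ with $C_2\le\Psi(t)t^m$ for an unbounded set of $t\ge1$. Then for Lebesgue almost every $(\theta_3,\dots,\theta_m)\in\mathbb{R}^{m-2}$, the vector $(\theta_1,\theta_2,\theta_3,\dots,\theta_m)\in\mathbb{R}^m$ is non-singular.
   Context: For $\theta\in\mathbb{R}^2$, $\Psi(t)=\min\{\langle a_1\theta_1+a_2\theta_2\rangle:(a_1,a_2)\in\mathbb{Z}^2\smallsetminus\{0\},\max_i|a_i|\le t\}$ for $t\ge1$, where $\langle s\rangle$ is the distance from $s$ to the nearest integer. A vector $\vartheta\in\mathbb{R}^m$ (viewed as an $m\times1$ matrix) is singular if for every $\varepsilon>0$ and all sufficiently large $Q$, $Q^{1/m}\min\{\langle q\vartheta\rangle:q\in\mathbb{Z}\smallsetminus\{0\},|q|\le Q\}<\varepsilon$, where $\langle z\rangle=\min_{p\in\mathbb{Z}^m}\|z-p\|$ for a fixed norm; non-singular otherwise. *)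

theory Defs
  imports "HOL-Analysis.Analysis"
begin

definition dist_nearest_int :: "real \<Rightarrow> real" where
  "dist_nearest_int s = \<bar>s - of_int (round s)\<bar>"

text \<open>The irrationality measure function of a vector in the plane. It is meaningful for
  \<open>t \<ge> 1\<close>, where the minimum is over a finite nonempty set.\<close>

definition irrationality_measure_fn :: "real ^ 2 \<Rightarrow> real \<Rightarrow> real" where
  "irrationality_measure_fn \<theta> t =
     Min ((\<lambda>(a\<^sub>1, a\<^sub>2). dist_nearest_int (of_int a\<^sub>1 * \<theta> $ 1 + of_int a\<^sub>2 * \<theta> $ 2)) `
          {(a\<^sub>1 :: int, a\<^sub>2 :: int). (a\<^sub>1, a\<^sub>2) \<noteq> (0, 0) \<and> of_int (max \<bar>a\<^sub>1\<bar> \<bar>a\<^sub>2\<bar>) \<le> t})"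

text \<open>Norms are treated as functions rather than through the type class, so that the fixed norm
  on the space can be arbitrary and not just the Euclidean one. Nonnegativity follows.\<close>

definition is_norm :: "('v :: real_vector \<Rightarrow> real) \<Rightarrow> bool" where
  "is_norm N \<longleftrightarrow>
     (\<forall>x. N x = 0 \<longleftrightarrow> x = 0) \<and>
     (\<forall>x y. N (x + y) \<le> N x + N y) \<and>
     (\<forall>c x. N (c *\<^sub>R x) = \<bar>c\<bar> * N x)"

text \<open>For a norm \<open>N\<close> the infimum below is attained, since a ball contains only finitely many
  integer points.\<close>

definition lattice_dist :: "(real ^ 'm \<Rightarrow> real) \<Rightarrow> real ^ 'm \<Rightarrow> real" where
  "lattice_dist N z = (INF p \<in> {p. \<forall>i. p $ i \<in> \<int>}. N (z - p))"

definition singular_vec :: "(real ^ 'm \<Rightarrow> real) \<Rightarrow> real ^ 'm \<Rightarrow> bool" where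
  "singular_vec N \<theta> \<longleftrightarrow>
     (\<forall>\<epsilon>>0. \<forall>\<^sub>F Q :: real in at_top.
        Q powr (1 / real CARD('m)) *
          Min ((\<lambda>q. lattice_dist N (of_int q *\<^sub>R \<theta>)) ` {q :: int. q \<noteq> 0 \<and> of_int \<bar>q\<bar> \<le> Q}) < \<epsilon>)"

text \<open>Concatenation of coordinates: the index type \<open>'k + 'n\<close> is the disjoint sum, so it has
  \<open>CARD('k) + CARD('n)\<close> elements.\<close>

definition vec_append :: "real ^ 'k \<Rightarrow> real ^ 'n \<Rightarrow> real ^ ('k + 'n)" where
  "vec_append x y = (\<chi> i. case i of Inl j \<Rightarrow> x $ j | Inr j \<Rightarrow> y $ j)"

end

theory Submission imports Defs begin

text \<open>
  By transference, a singular vector \<open>\<xi>\<close> in dimension \<open>m\<close> also satisfies the dual condition: for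
  every \<open>\<epsilon>\<close> and all large \<open>t\<close>, some nonzero integer vector \<open>a\<close> with entries at most \<open>t\<close> brings
  \<open>a \<bullet> \<xi>\<close> within \<open>\<epsilon> / t ^ m\<close> of an integer. Take \<open>\<xi> = (\<theta>, \<eta>)\<close>, \<open>\<epsilon> \<le> C\<^sub>2\<close> and \<open>t\<close> in the given
  unbounded set. Then \<open>a\<close> cannot be supported on the first two coordinates, so \<open>\<eta>\<close> lies in one of
  \<open>O(t ^ m)\<close> sets whose measure in a fixed cube is \<open>O(\<epsilon> / t ^ m)\<close>. Thus the singular \<open>\<eta>\<close> of the cube
  eventually belong to sets of measure \<open>O(\<epsilon>)\<close>, uniformly in \<open>t\<close>, and form a null set.
\<close>

section \<open>Nearest integers and norms on Euclidean space\<close>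

lemma dist_nearest_int_less_iff: "dist_nearest_int s < \<delta> \<longleftrightarrow> (\<exists>p::int. \<bar>s - p\<bar> < \<delta>)"
  unfolding dist_nearest_int_def
  by (metis abs_minus_commute le_less_trans round_diff_minimal)

text \<open>Compactness: \<open>N\<close> is Lipschitz for the Euclidean norm, so it attains a
  positive minimum on the unit sphere, and homogeneity carries the bound to all vectors. This turns
  smallness in an arbitrary norm into smallness of each coordinate.\<close>

lemma is_norm_lower_bound:
  fixes N :: "real ^ 'm::finite \<Rightarrow> real"
  assumes "is_norm N"
  obtains \<kappa> where "\<kappa> > 0" "\<And>x. \<kappa> * norm x \<le> N x"
proof -
  have N0: "N x = 0 \<longleftrightarrow> x = 0" and tri: "N (x + y) \<le> N x + N y" and scale: "N (c *\<^sub>R x) = \<bar>c\<bar> * N x" for x y c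
    using assms by (auto simp: is_norm_def)
  have minus: "N (- x) = N x" for x
    using scale[of "-1" x] by simp
  have N_zero: "N 0 = 0" using N0[of 0] by blast
  have nonneg: "0 \<le> N x" for x
    using tri[of x "-x"] minus[of x] N_zero by simp
  have N_sum: "N (sum f I) \<le> (\<Sum>i\<in>I. N (f i))" if "finite I" for f and I :: "'m set"
    using that
  proof (induction I)
    case (insert i I)
    then show ?case using tri[of "f i" "sum f I"] by simp
  qed (simp add: N_zero)
  define B where "B = (\<Sum>i\<in>UNIV. N (axis i (1::real) :: real ^ 'm))"
  have upper: "N x \<le> B * norm x" for x
  proof -
    have "N x = N (\<Sum>i\<in>UNIV. x $ i *\<^sub>R axis i 1)"
      by (simp add: basis_expansion flip: scalar_mult_eq_scaleR)
    also have "\<dots> \<le> (\<Sum>i\<in>UNIV. N (x $ i *\<^sub>R axis i 1))"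
      by (rule N_sum) simp
    also have "\<dots> \<le> (\<Sum>i\<in>UNIV. norm x * N (axis i 1))"
      by (rule sum_mono) (simp add: scale component_le_norm_cart mult_right_mono nonneg)
    finally show ?thesis by (simp add: B_def sum_distrib_left mult.commute)
  qed
  have diff: "\<bar>N x - N y\<bar> \<le> B * norm (x - y)" for x y
    using tri[of "x - y" y] tri[of "y - x" x] upper[of "x - y"] minus[of "x - y"] by simp
  have "continuous_on UNIV N"
  proof (rule continuous_at_imp_continuous_on, rule ballI)
    fix y
    have "((\<lambda>x. N x - N y) \<longlongrightarrow> 0) (at y)"
    proof (rule Lim_null_comparison)
      show "\<forall>\<^sub>F x in at y. norm (N x - N y) \<le> B * norm (x - y)"
        using diff by simp
      show "((\<lambda>x. B * norm (x - y)) \<longlongrightarrow> 0) (at y)"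
        by (auto intro!: tendsto_eq_intros)
    qed
    then show "isCont N y"
      by (simp add: isCont_def LIM_zero_iff)
  qed
  then have cont: "continuous_on (sphere 0 1) N"
    using continuous_on_subset by blast
  \<comment> \<open>\<open>undefined\<close> is just some index; any unit vector shows that the
    sphere is nonempty.\<close>
  have "axis undefined 1 \<in> sphere (0 :: real ^ 'm) 1"
    by (simp add: norm_axis_1)
  then obtain u where u: "u \<in> sphere 0 1" "\<And>v. v \<in> sphere 0 1 \<Longrightarrow> N u \<le> N v"
    using continuous_attains_inf[OF compact_sphere _ cont] by blast
  show thesis
  proof
    have "u \<noteq> 0" using u by auto
    then show "N u > 0" using nonneg[of u] N0[of u] by simp
    fix x
    show "N u * norm x \<le> N x"
    proof (cases "x = 0")
      case False
      then have "N u \<le> N ((1 / norm x) *\<^sub>R x)"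
        by (intro u) simp
      with False show ?thesis by (simp add: scale field_simps)
    qed (simp add: N_zero)
  qed
qed

section \<open>Transference from simultaneous approximation to linear forms\<close>

text \<open>Pigeonhole on the vectors \<open>a\<close> with entries in \<open>{0..\<lfloor>t\<rfloor>}\<close>: two of them agree in \<open>a \<bullet> p\<close> modulo
  \<open>q\<close> and are close in \<open>a \<bullet> (q\<xi> - p)\<close>. Refining the second quantity into about \<open>t ^ m / q\<close> boxes is
  what keeps the final bound independent of \<open>q\<close>.\<close>

lemma simultaneous_to_dual_approx:
  fixes \<xi> :: "real ^ 'm::finite" and q :: int and p :: "'m \<Rightarrow> int" and t c :: real
  assumes t: "t \<ge> 1" and q: "q \<ge> 1" "2 * real_of_int q \<le> t ^ CARD('m)" and c: "c > 0"
    and approx: "\<And>i. \<bar>q * \<xi> $ i - p i\<bar> < c / t"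
  obtains a :: "'m \<Rightarrow> int" and b :: int
  where "\<exists>i. a i \<noteq> 0" "\<And>i. \<bar>a i\<bar> \<le> t"
    "\<bar>(\<Sum>i\<in>UNIV. a i * \<xi> $ i) - b\<bar> \<le> 4 * CARD('m) * c / t ^ CARD('m)"
proof -
  define T where "T = t ^ CARD('m)"
  define A where "A = \<lfloor>t\<rfloor>"
  define D where "D = (UNIV :: 'm set) \<rightarrow>\<^sub>E {0..A}"
  define L where "L = \<lfloor>T / q\<rfloor>"
  define M where "M = CARD('m) * c"
  define x where "x i = q * \<xi> $ i - p i" for i
  define dot where "dot a = (\<Sum>i\<in>UNIV. of_int (a i) * x i)" for a :: "'m \<Rightarrow> int"
  \<comment> \<open>\<open>g a\<close> records the residue of a . p modulo \<open>q\<close> and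
    which of \<open>L\<close> equal subintervals of [-M, M] contains \<open>dot a\<close>. The
    choice of \<open>L\<close> keeps the number of pigeonholes, \<open>q * L\<close>, at most
    \<open>T\<close>.\<close>
  define g where "g a = ((\<Sum>i\<in>UNIV. a i * p i) mod q, \<lfloor>(dot a + M) * (L / (2 * M))\<rfloor>)" for a
  have M: "M > 0" using c by (simp add: M_def)
  \<comment> \<open>Since T / q is at least 2, rounding it down to \<open>L\<close> costs at most a
    factor 2; this is \<open>L_lower\<close>.\<close>
  have "2 \<le> T / q" using q by (simp add: T_def field_simps)
  then have L2: "L \<ge> 2" by (simp add: L_def le_floor_iff)
  have L_upper: "L * q \<le> T"
  proof -
    have "real_of_int L \<le> T / q" by (simp add: L_def)
    then show ?thesis using q by (simp add: field_simps)
  qed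
  have L_lower: "T \<le> 2 * L * q"
  proof -
    have "T / q < L + 1" unfolding L_def by linarith
    then have "T / q \<le> 2 * L" using L2 by linarith
    then show ?thesis using q by (simp add: field_simps)
  qed
  have A: "A \<ge> 1" "A \<le> t" "t < A + 1" using t by (auto simp: A_def le_floor_iff)
  have dot_less: "\<bar>dot a\<bar> < M" if "a \<in> D" for a
  proof -
    have "\<bar>dot a\<bar> \<le> (\<Sum>i\<in>UNIV. \<bar>of_int (a i) * x i\<bar>)"
      unfolding dot_def by (rule sum_abs)
    also have "\<dots> < (\<Sum>i\<in>(UNIV::'m set). c)"
    proof (rule sum_strict_mono)
      fix i
      have "0 \<le> a i" "a i \<le> A" using that by (auto simp: D_def PiE_iff)
      then have "\<bar>of_int (a i)\<bar> \<le> t" using A by linarith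
      then have "\<bar>of_int (a i) * x i\<bar> \<le> t * \<bar>x i\<bar>"
        by (simp add: abs_mult mult_right_mono)
      also have "\<dots> < c" using approx[of i] t by (simp add: x_def field_simps)
      finally show "\<bar>of_int (a i) * x i\<bar> < c" .
    qed auto
    finally show ?thesis by (simp add: M_def)
  qed
  have "g ` D \<subseteq> {0..<q} \<times> {0..<L}"
  proof
    fix y assume "y \<in> g ` D"
    then obtain a where a: "a \<in> D" "y = g a" by blast
    have pos: "(dot a + M) * (L / (2 * M)) \<ge> 0" 
      using dot_less[OF a(1)] M L2 by (intro mult_nonneg_nonneg) auto
    have "(dot a + M) * (L / (2 * M)) < 2 * M * (L / (2 * M))"
      using dot_less[OF a(1)] M L2 by (intro mult_strict_right_mono) auto
    then have "(dot a + M) * (L / (2 * M)) < L" using M by simp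
    with pos show "y \<in> {0..<q} \<times> {0..<L}"
      using q by (auto simp: a(2) g_def floor_less_iff)
  qed
  then have "card (g ` D) \<le> card ({0..<q} \<times> {0..<L})"
    by (intro card_mono) auto
  also have "\<dots> = nat (L * q)" using q L2 by (simp add: nat_mult_distrib)
  also have "\<dots> < card D"
  proof -
    \<comment> \<open>\<open>D\<close> has (A + 1)^m elements, and t < A + 1 makes this strictly
      more than \<open>T\<close>, hence more than the pigeonholes.\<close>
    have "L * q < (A + 1) ^ CARD('m)"
    proof -
      have "real_of_int (L * q) \<le> T" using L_upper by simp
      also have "\<dots> < (real_of_int A + 1) ^ CARD('m)"
        unfolding T_def using A t by (intro power_strict_mono) auto
      finally have "real_of_int (L * q) < real_of_int ((A + 1) ^ CARD('m))" by simp
      then show ?thesis by linarith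
    qed
    moreover have "card D = nat (A + 1) ^ CARD('m)" 
      using A by (simp add: D_def card_PiE)
    ultimately show ?thesis using A by (simp add: nat_less_iff nat_power_eq flip: nat_power_eq)
  qed
  finally have "\<not> inj_on g D" by (rule pigeonhole)
  then obtain a a' where aa: "a \<in> D" "a' \<in> D" "a \<noteq> a'" "g a = g a'"
    by (auto simp: inj_on_def)
  \<comment> \<open>Equal residues make the difference of the integer parts a multiple of
    \<open>q\<close>; equal boxes put the two values of \<open>dot\<close> within one box length 2M
    / L.\<close>
  from aa(4) have "q dvd (\<Sum>i\<in>UNIV. a i * p i) - (\<Sum>i\<in>UNIV. a' i * p i)"
    by (simp add: g_def mod_eq_dvd_iff)
  then obtain b where b: "(\<Sum>i\<in>UNIV. a i * p i) - (\<Sum>i\<in>UNIV. a' i * p i) = q * b" by blast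
  have diff: "\<bar>(dot a + M) * (L / (2 * M)) - (dot a' + M) * (L / (2 * M))\<bar> < 1"
    using aa(4) unfolding g_def by simp linarith
  have "(dot a + M) * (L / (2 * M)) - (dot a' + M) * (L / (2 * M)) = (dot a - dot a') * (L / (2 * M))"
    by (simp only: left_diff_distrib distrib_right add_diff_cancel_right)
  with diff have "\<bar>(dot a - dot a') * (L / (2 * M))\<bar> < 1"
    by (simp only:)
  then have "\<bar>dot a - dot a'\<bar> * (L / (2 * M)) < 1"
    using M L2 by (simp only: abs_mult) simp
  then have close: "\<bar>dot a - dot a'\<bar> * L < 2 * M"
    using M by (simp add: field_simps)
  \<comment> \<open>Trading \<open>L\<close> for T / (2q) brings in a factor \<open>q\<close>. It
    cancels below, because \<open>dot a - dot a'\<close> is \<open>q\<close> times the quantity to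
    be bounded.\<close>
  have "\<bar>dot a - dot a'\<bar> * T \<le> \<bar>dot a - dot a'\<bar> * (2 * L * q)"
    using L_lower by (intro mult_left_mono) auto
  also have "\<dots> = (\<bar>dot a - dot a'\<bar> * L) * (2 * q)" by simp
  also have "\<dots> \<le> 2 * M * (2 * q)"
    using close q by (intro mult_right_mono) auto
  finally have small: "\<bar>dot a - dot a'\<bar> * T \<le> 4 * M * q" by simp
  show thesis
  proof (rule that[of "\<lambda>i. a i - a' i" b])
    show "\<exists>i. a i - a' i \<noteq> 0" using aa(3) by auto
    fix i
    have "a i \<in> {0..A}" "a' i \<in> {0..A}" using aa by (auto simp: D_def PiE_iff)
    then have "\<bar>a i - a' i\<bar> \<le> A" by auto
    then have "real_of_int \<bar>a i - a' i\<bar> \<le> A" by linarith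
    then show "real_of_int \<bar>a i - a' i\<bar> \<le> t" using A by linarith
  next
    have "dot a - dot a' = q * (\<Sum>i\<in>UNIV. of_int (a i - a' i) * \<xi> $ i)
        - real_of_int ((\<Sum>i\<in>UNIV. a i * p i) - (\<Sum>i\<in>UNIV. a' i * p i))"
      by (simp add: dot_def x_def sum_distrib_left algebra_simps sum_subtractf sum.distrib)
    also have "\<dots> = q * ((\<Sum>i\<in>UNIV. of_int (a i - a' i) * \<xi> $ i) - b)"
      by (simp only: b) (simp add: algebra_simps)
    finally have "\<bar>dot a - dot a'\<bar> = q * \<bar>(\<Sum>i\<in>UNIV. of_int (a i - a' i) * \<xi> $ i) - b\<bar>"
      using q by (simp add: abs_mult)
    with small have "q * (\<bar>(\<Sum>i\<in>UNIV. of_int (a i - a' i) * \<xi> $ i) - b\<bar> * T) \<le> q * (4 * M)"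
      by (simp add: mult_ac)
    then have "\<bar>(\<Sum>i\<in>UNIV. of_int (a i - a' i) * \<xi> $ i) - b\<bar> * T \<le> 4 * M"
      using q by simp
    moreover have "T > 0" using t by (simp add: T_def)
    ultimately show "\<bar>(\<Sum>i\<in>UNIV. of_int (a i - a' i) * \<xi> $ i) - b\<bar> \<le> 4 * CARD('m) * c / t ^ CARD('m)"
      by (simp add: field_simps M_def T_def)
  qed
qed

text \<open>Singularity is applied with Q = t^m / 2. The m-th root of this Q has order t, so the
  coordinate errors come out below c / t, and it is the largest range of \<open>q\<close> that
  \<open>simultaneous_to_dual_approx\<close> admits.\<close>

lemma singular_vec_imp_dual_small:
  fixes N :: "real ^ 'm::finite \<Rightarrow> real"
  assumes N: "is_norm N" and sing: "singular_vec N \<xi>" and \<epsilon>: "\<epsilon> > 0"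
  shows "\<forall>\<^sub>F t :: real in at_top. \<exists>a :: 'm \<Rightarrow> int. (\<exists>i. a i \<noteq> (0::int)) \<and> (\<forall>i. \<bar>a i\<bar> \<le> t) \<and>
           dist_nearest_int (\<Sum>i\<in>UNIV. a i * \<xi> $ i) < \<epsilon> / t ^ CARD('m)"
proof -
  obtain \<kappa> where \<kappa>: "\<kappa> > 0" "\<And>x. \<kappa> * norm x \<le> N x"
    using is_norm_lower_bound[OF N] by blast
  have N_nonneg: "0 \<le> N x" for x
    using \<kappa>(2)[of x] \<kappa>(1) by (meson mult_nonneg_nonneg norm_ge_zero less_imp_le order_trans)
  \<comment> \<open>With this \<open>c\<close> the final bound is half of \<epsilon> / t^m, hence
    strictly smaller. In \<open>\<epsilon>'\<close>, \<kappa> passes from \<open>N\<close> to the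
    Euclidean norm, and the factor 1/2 pays for t / 2 as a lower bound of the m-th root of
    \<open>Q\<close>.\<close>
  define c where "c = \<epsilon> / (8 * CARD('m))"
  define \<epsilon>' where "\<epsilon>' = \<kappa> * c / 2"
  have c: "c > 0" using \<epsilon> by (simp add: c_def)
  have "\<epsilon>' > 0" using \<kappa> c by (simp add: \<epsilon>'_def)
  then have "\<forall>\<^sub>F Q :: real in at_top. Q powr (1 / real CARD('m)) *
          Min ((\<lambda>q. lattice_dist N (of_int q *\<^sub>R \<xi>)) ` {q :: int. q \<noteq> 0 \<and> of_int \<bar>q\<bar> \<le> Q}) < \<epsilon>'"
    using sing by (simp add: singular_vec_def)
  moreover have "filterlim (\<lambda>t :: real. t ^ CARD('m) / 2) at_top at_top"
    unfolding divide_inverse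
    by (rule filterlim_at_top_mult_tendsto_pos[OF tendsto_const]) (auto intro: filterlim_pow_at_top filterlim_ident)
  ultimately have ev: "\<forall>\<^sub>F t :: real in at_top. (t ^ CARD('m) / 2) powr (1 / real CARD('m)) *
          Min ((\<lambda>q. lattice_dist N (of_int q *\<^sub>R \<xi>)) ` {q :: int. q \<noteq> 0 \<and> of_int \<bar>q\<bar> \<le> t ^ CARD('m) / 2}) < \<epsilon>'"
    by (rule eventually_compose_filterlim)
  show ?thesis
    using ev eventually_ge_at_top[of 2]
  proof eventually_elim
    case (elim t)
    define Q where "Q = t ^ CARD('m) / 2"
    let ?X = "{q :: int. q \<noteq> 0 \<and> of_int \<bar>q\<bar> \<le> Q}"
    \<comment> \<open>From t \<ge> 2 on, \<open>Q\<close> is at least 1, so the minimum is over a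
      nonempty set and some \<open>q\<close> attains it.\<close>
    have "2 ^ 1 \<le> (2::real) ^ CARD('m)"
      by (rule power_increasing) (auto simp: Suc_le_eq)
    also have "\<dots> \<le> t ^ CARD('m)" using elim by (intro power_mono) auto
    finally have Q1: "Q \<ge> 1" by (simp add: Q_def)
    have "?X \<subseteq> {-\<lfloor>Q\<rfloor>..\<lfloor>Q\<rfloor>}"
      by (auto simp: le_floor_iff abs_le_iff) linarith
    then have "finite ?X" using finite_subset by blast
    moreover have "1 \<in> ?X" using Q1 by simp
    ultimately have "Min ((\<lambda>q. lattice_dist N (of_int q *\<^sub>R \<xi>)) ` ?X) \<in> (\<lambda>q. lattice_dist N (of_int q *\<^sub>R \<xi>)) ` ?X"
      by (intro Min_in) blast+
    then obtain q where q: "q \<in> ?X" "Q powr (1 / real CARD('m)) * lattice_dist N (of_int q *\<^sub>R \<xi>) < \<epsilon>'"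
      using elim unfolding Q_def by auto
    have root: "t / 2 \<le> Q powr (1 / real CARD('m))"
    proof -
      have "(t / 2) ^ CARD('m) \<le> Q"
      proof -
        have "2 ^ 1 \<le> (2::real) ^ CARD('m)"
          by (rule power_increasing) (auto simp: Suc_le_eq)
        then have "t ^ CARD('m) / 2 ^ CARD('m) \<le> t ^ CARD('m) / 2"
          using elim by (intro divide_left_mono) auto
        then show ?thesis by (simp only: Q_def power_divide)
      qed
      then have "((t / 2) ^ CARD('m)) powr (1 / real CARD('m)) \<le> Q powr (1 / real CARD('m))"
        using elim by (intro powr_mono2) auto
      moreover have "((t / 2) ^ CARD('m)) powr (1 / real CARD('m)) = t / 2"
        using elim by (simp add: powr_powr flip: powr_realpow)
      ultimately show ?thesis by simp
    qed
    have ne: "(\<lambda>p. N (of_int q *\<^sub>R \<xi> - p)) ` {p. \<forall>i. p $ i \<in> \<int>} \<noteq> {}"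
      by (auto intro!: exI[of _ 0])
    have dist_nonneg: "0 \<le> lattice_dist N (of_int q *\<^sub>R \<xi>)"
      unfolding lattice_dist_def by (rule cINF_greatest) (use ne N_nonneg in auto)
    have "t / 2 * lattice_dist N (of_int q *\<^sub>R \<xi>) < \<epsilon>'"
      using mult_right_mono[OF root dist_nonneg] q(2) by simp
    then have "lattice_dist N (of_int q *\<^sub>R \<xi>) < \<kappa> * (c / t)"
      using elim by (simp add: \<epsilon>'_def field_simps)
    then obtain v where v: "\<And>i. v $ i \<in> \<int>" "N (of_int q *\<^sub>R \<xi> - v) < \<kappa> * (c / t)"
      unfolding lattice_dist_def using cInf_lessD[OF ne] by auto
    have "\<kappa> * norm (of_int q *\<^sub>R \<xi> - v) < \<kappa> * (c / t)"
      using \<kappa>(2) v(2) by (rule le_less_trans)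
    then have norm_less: "norm (of_int q *\<^sub>R \<xi> - v) < c / t"
      using \<kappa>(1) by (simp only: mult_less_cancel_left_pos)
    have coord: "\<bar>of_int q * \<xi> $ i - of_int \<lfloor>v $ i\<rfloor>\<bar> < c / t" for i
    proof -
      have v_floor: "of_int \<lfloor>v $ i\<rfloor> = v $ i" using v(1)[of i] by (metis Ints_cases floor_of_int)
      then show ?thesis
        using component_le_norm_cart[of "of_int q *\<^sub>R \<xi> - v" i] norm_less
        unfolding v_floor by simp
    qed
    have q': "\<bar>q\<bar> \<ge> 1" "2 * real_of_int \<bar>q\<bar> \<le> t ^ CARD('m)"
      using q(1) by (auto simp: Q_def)
    \<comment> \<open>The minimum admits negative \<open>q\<close>; multiplying the approximation by
      \<open>sgn q\<close> makes the denominator positive.\<close>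
    have coord': "\<bar>of_int \<bar>q\<bar> * \<xi> $ i - of_int (sgn q * \<lfloor>v $ i\<rfloor>)\<bar> < c / t" for i
      using coord[of i] q(1) by (cases "q > 0") (auto simp: abs_minus_commute)
    have "1 \<le> t" using elim by simp
    from simultaneous_to_dual_approx[OF this q' c coord'] obtain a :: "'m \<Rightarrow> int" and b :: int
      where a: "\<exists>i. a i \<noteq> 0" "\<And>i. \<bar>a i\<bar> \<le> t"
        "\<bar>(\<Sum>i\<in>UNIV. a i * \<xi> $ i) - b\<bar> \<le> 4 * CARD('m) * c / t ^ CARD('m)" by blast
    have "4 * CARD('m) * c / t ^ CARD('m) < \<epsilon> / t ^ CARD('m)"
      using \<epsilon> elim by (intro divide_strict_right_mono) (auto simp: c_def)
    with a show ?case
      by (auto simp: dist_nearest_int_less_iff intro!: exI[of _ a] exI[of _ b])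
  qed
qed

section \<open>Measure of the set where a linear form is nearly an integer\<close>

text \<open>The translates of the set along a coordinate with nonzero coefficient, in steps that
  change the linear form by \<open>2 * \<delta>\<close>, are disjoint and stay in a slightly larger cube.\<close>

lemma measure_linear_form_near_int:
  fixes b :: "'n::finite \<Rightarrow> int" and s \<delta> R :: real
  assumes bj: "b j \<noteq> 0" and \<delta>: "0 < \<delta>" "\<delta> \<le> 1/4" and R: "R \<ge> 0"
  defines "E \<equiv> {\<eta> \<in> cbox (vec (- R)) (vec R) :: (real ^ 'n) set.
    dist_nearest_int (s + (\<Sum>i\<in>UNIV. b i * \<eta> $ i)) < \<delta>}"
  shows "E \<in> lmeasurable" and "measure lebesgue E \<le> 4 * \<delta> * (2 * R + 2) ^ CARD('n)"
proof -
  define f where "f \<eta> = s + (\<Sum>i\<in>UNIV. b i * \<eta> $ i)" for \<eta> :: "real ^ 'n"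
  have cont: "continuous_on UNIV f"
    unfolding f_def by (intro continuous_intros)
  have E_eq: "E = cbox (vec (- R)) (vec R) \<inter> (\<Union>p::int. {\<eta>. \<bar>f \<eta> - p\<bar> < \<delta>})"
    by (auto simp: E_def f_def dist_nearest_int_less_iff)
  have "open {\<eta>. \<bar>f \<eta> - p\<bar> < \<delta>}" for p :: real
    by (intro open_Collect_less continuous_intros cont)
  then have "open (\<Union>p::int. {\<eta>. \<bar>f \<eta> - p\<bar> < \<delta>})"
    by blast
  then show meas: "E \<in> lmeasurable"
    unfolding E_eq
    by (intro bounded_set_imp_lmeasurable) (auto intro: bounded_subset[OF bounded_cbox])
  \<comment> \<open>\<open>K\<close> steps of length 2 \<delta> fit in a unit interval. Because
    \<delta> \<le> 1/4, rounding down still leaves 4 \<delta> K at least 1.\<close>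
  define K where "K = nat \<lfloor>1 / (2 * \<delta>)\<rfloor>"
  have K_eq: "real K = \<lfloor>1 / (2 * \<delta>)\<rfloor>" using \<delta> by (simp add: K_def)
  have K_upper: "2 * \<delta> * K \<le> 1"
  proof -
    have "K \<le> 1 / (2 * \<delta>)" unfolding K_eq by linarith
    then show ?thesis using \<delta> by (simp add: field_simps)
  qed
  have K_lower: "1 \<le> 4 * \<delta> * K"
  proof -
    have "1 / (2 * \<delta>) - 1 < K" unfolding K_eq by linarith
    then show ?thesis using \<delta> by (simp add: field_simps)
  qed
  \<comment> \<open>Dividing by \<open>b j\<close> makes the linear form grow by exactly 2 \<delta>
    k, whatever the size of the coefficient.\<close>
  define v where "v k = axis j (2 * \<delta> * real k / b j)" for k
  define F where "F k = (+) (v k) ` E" for k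
  have f_add: "f (v k + \<eta>) = f \<eta> + 2 * \<delta> * k" for k \<eta>
  proof -
    have "(\<Sum>i\<in>UNIV. b i * v k $ i) = (\<Sum>i\<in>UNIV. if i = j then 2 * \<delta> * k else 0)"
      using bj by (intro sum.cong) (auto simp: v_def axis_def)
    then show ?thesis
      by (simp add: f_def distrib_left sum.distrib)
  qed
  \<comment> \<open>If two copies met, f y - f x = 2 \<delta> (k - l) would be less than 2 \<delta>
    away from an integer. Its absolute value is at least 2 \<delta>, which excludes zero, and at
    most 1 - 2 \<delta>, which excludes every other integer.\<close>
  have "disjnt (F k) (F l)" if "k < K" "l < K" "k \<noteq> l" for k l
  proof (rule ccontr)
    assume "\<not> disjnt (F k) (F l)"
    then obtain x y where xy: "x \<in> E" "y \<in> E" "v k + x = v l + y"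
      by (auto simp: disjnt_def F_def)
    obtain p p' :: int where p: "\<bar>f x - p\<bar> < \<delta>" "\<bar>f y - p'\<bar> < \<delta>"
      using xy by (auto simp: E_eq)
    define d where "d = real k - real l"
    have "f x + 2 * \<delta> * k = f y + 2 * \<delta> * l"
      using arg_cong[OF xy(3), of f] by (simp add: f_add)
    then have fd: "f y - f x = 2 * \<delta> * d" by (simp add: d_def algebra_simps)
    have d1: "\<bar>d\<bar> \<ge> 1" and d2: "\<bar>d\<bar> \<le> real K - 1"
      using that unfolding d_def by linarith+
    have "2 * \<delta> * \<bar>d\<bar> \<le> 2 * \<delta> * (real K - 1)" using d2 \<delta> by (intro mult_left_mono) auto
    then have up: "\<bar>2 * \<delta> * d\<bar> \<le> 1 - 2 * \<delta>" using K_upper \<delta> by (simp add: abs_mult algebra_simps)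
    have "2 * \<delta> * 1 \<le> 2 * \<delta> * \<bar>d\<bar>" using d1 \<delta> by (intro mult_left_mono) auto
    then have low: "2 * \<delta> \<le> \<bar>2 * \<delta> * d\<bar>" using \<delta> by (simp add: abs_mult)
    have diff: "\<bar>2 * \<delta> * d - of_int (p' - p)\<bar> < 2 * \<delta>" using p fd by simp
    show False
    proof (cases "p' = p")
      case True
      with diff low show False by simp
    next
      case False
      then have "\<bar>p' - p\<bar> \<ge> 1" by linarith
      then have "\<bar>real_of_int (p' - p)\<bar> \<ge> 1" by linarith
      with diff up show False by linarith
    qed
  qed
  then have disj: "pairwise (\<lambda>k l. disjnt (F k) (F l)) {..<K}"
    by (auto simp: pairwise_def)
  \<comment> \<open>A nonzero integer has |b j| \<ge> 1, so no shift exceeds 1. The enlarged cube,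
    and with it the final bound, has a size independent of \<open>b\<close>.\<close>
  have sub: "F k \<subseteq> cbox (vec (- (R + 1))) (vec (R + 1))" if "k < K" for k
  proof
    fix y assume "y \<in> F k"
    then obtain x where x: "x \<in> cbox (vec (- R)) (vec R)" "y = v k + x"
      by (auto simp: F_def E_def)
    have "2 * \<delta> * k \<le> 2 * \<delta> * K" using that \<delta> by simp
    then have "2 * \<delta> * k \<le> 1 * 1" using K_upper by simp
    also have "\<dots> \<le> 1 * \<bar>real_of_int (b j)\<bar>" using bj by linarith
    finally have "\<bar>2 * \<delta> * k / b j\<bar> \<le> 1" using bj \<delta> by (simp add: abs_mult field_simps)
    then have "\<bar>v k $ i\<bar> \<le> 1" for i
      by (simp add: v_def axis_def)
    moreover have "- R \<le> x $ i" "x $ i \<le> R" for i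
      using x(1) by (auto simp: mem_box_cart)
    ultimately show "y \<in> cbox (vec (- (R + 1))) (vec (R + 1))"
      unfolding mem_box_cart x(2) 
      by (smt (verit, best) vec_component vector_add_component)
  qed
  have Fm: "F k \<in> lmeasurable" for k
    unfolding F_def by (rule measurable_translation[OF meas])
  have "K * measure lebesgue E = (\<Sum>k<K. measure lebesgue (F k))"
    by (simp add: F_def measure_translation)
  also have "\<dots> = measure lebesgue (\<Union>k<K. F k)"
    by (rule measure_UNION'[symmetric]) (use Fm disj in auto)
  also have "\<dots> \<le> measure lebesgue (cbox (vec (- (R + 1))) (vec (R + 1)) :: (real ^ 'n) set)"
    using sub Fm by (intro measure_mono_fmeasurable) auto
  also have "\<dots> = (2 * R + 2) ^ CARD('n)"
    using R by (simp add: content_cbox_cart interval_ne_empty_cart)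
  finally have "K * measure lebesgue E \<le> (2 * R + 2) ^ CARD('n)" .
  then have "4 * \<delta> * (K * measure lebesgue E) \<le> 4 * \<delta> * (2 * R + 2) ^ CARD('n)"
    using \<delta> by (intro mult_left_mono) auto
  moreover have "1 * measure lebesgue E \<le> (4 * \<delta> * K) * measure lebesgue E"
    using K_lower by (intro mult_right_mono) auto
  ultimately show "measure lebesgue E \<le> 4 * \<delta> * (2 * R + 2) ^ CARD('n)"
    by (simp add: mult.assoc)
qed

section \<open>Auxiliary facts on integer forms, null sets and counting\<close>

lemma irrationality_measure_fn_le:
  fixes a :: "2 \<Rightarrow> int" and t :: real
  assumes "\<exists>i. a i \<noteq> 0" "\<And>i. \<bar>a i\<bar> \<le> t"
  shows "irrationality_measure_fn \<theta> t \<le> dist_nearest_int (\<Sum>i\<in>UNIV. a i * \<theta> $ i)"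
proof -
  let ?X = "{(a\<^sub>1 :: int, a\<^sub>2 :: int). (a\<^sub>1, a\<^sub>2) \<noteq> (0, 0) \<and> of_int (max \<bar>a\<^sub>1\<bar> \<bar>a\<^sub>2\<bar>) \<le> t}"
  have "?X \<subseteq> {-\<lfloor>t\<rfloor>..\<lfloor>t\<rfloor>} \<times> {-\<lfloor>t\<rfloor>..\<lfloor>t\<rfloor>}"
    by (auto simp: le_floor_iff; linarith)
  then have "finite ?X" by (rule finite_subset) simp
  moreover have "(a 1, a 2) \<in> ?X"
    using assms by (auto simp: exhaust_2 max_def) (metis exhaust_2)
  ultimately show ?thesis
    unfolding irrationality_measure_fn_def sum_2
    by (intro Min_le finite_imageI) (auto intro!: image_eqI[of _ _ "(a 1, a 2)"])
qed

lemma sum_vec_append: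
  fixes a :: "'k::finite + 'n::finite \<Rightarrow> real"
  shows "(\<Sum>i\<in>UNIV. a i * vec_append x y $ i) =
    (\<Sum>i\<in>UNIV. a (Inl i) * x $ i) + (\<Sum>i\<in>UNIV. a (Inr i) * y $ i)"
  by (simp add: vec_append_def UNIV_Plus_UNIV[symmetric] sum.Plus del: UNIV_Plus_UNIV)

text \<open>\<open>S\<close> lies in the increasing union of the tail intersections of the
  \<open>B k\<close>; each has measure at most \<open>e\<close>, so the union does too.
  Borel-Cantelli would ask for summable measures; here they are only uniformly bounded, but each
  point lies in all but finitely many \<open>B k\<close>.\<close>

lemma negligible_liminf:
  fixes S :: "'a::euclidean_space set"
  assumes "\<And>e. e > 0 \<Longrightarrow> \<exists>B :: nat \<Rightarrow> 'a set. (\<forall>k. B k \<in> lmeasurable \<and> measure lebesgue (B k) \<le> e) \<and>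
    (\<forall>x\<in>S. \<forall>\<^sub>F k in sequentially. x \<in> B k)"
  shows "negligible S"
  unfolding negligible_outer_le
proof (intro allI impI)
  fix e :: real
  assume "e > 0"
  then obtain B :: "nat \<Rightarrow> 'a set" where B: "\<And>k. B k \<in> lmeasurable" "\<And>k. measure lebesgue (B k) \<le> e"
    "\<And>x. x \<in> S \<Longrightarrow> \<forall>\<^sub>F k in sequentially. x \<in> B k"
    using assms by metis
  define C where "C n = (\<Inter>k\<in>{n..}. B k)" for n
  have C: "C n \<in> lmeasurable" for n
    unfolding C_def using B(1) by (intro fmeasurable_INT[of _ n]) auto
  have C_le: "measure lebesgue (C n) \<le> e" for n
  proof -
    have "measure lebesgue (C n) \<le> measure lebesgue (B n)"
      using B(1) C by (intro measure_mono_fmeasurable) (auto simp: C_def)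
    with B(2) show ?thesis using order_trans by blast
  qed
  have C_mono: "C n \<subseteq> C (Suc n)" for n
    by (auto simp: C_def)
  show "\<exists>T. S \<subseteq> T \<and> T \<in> lmeasurable \<and> measure lebesgue T \<le> e"
  proof (intro exI conjI)
    show "S \<subseteq> (\<Union>n. C n)"
      using B(3) by (fastforce simp: C_def eventually_sequentially)
    show "(\<Union>n. C n) \<in> lmeasurable"
      using C C_le C_mono by (rule measurable_nested_Union)
    show "measure lebesgue (\<Union>n. C n) \<le> e"
      by (rule LIMSEQ_le_const2[OF measure_nested_Union[of C, OF C C_le C_mono]]) (use C_le in auto)
  qed
qed

lemma card_int_functions_bounded_by:
  fixes t :: real
  assumes "t \<ge> 1"
  shows "finite {a :: 'm::finite \<Rightarrow> int. \<forall>i. \<bar>real_of_int (a i)\<bar> \<le> t}" (is "finite ?A")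
    and "card {a :: 'm::finite \<Rightarrow> int. \<forall>i. \<bar>real_of_int (a i)\<bar> \<le> t} \<le> (3 * t) ^ CARD('m)"
proof -
  have eq: "?A = UNIV \<rightarrow>\<^sub>E {-\<lfloor>t\<rfloor>..\<lfloor>t\<rfloor>}"
  proof -
    have "\<bar>real_of_int z\<bar> \<le> t \<longleftrightarrow> z \<in> {-\<lfloor>t\<rfloor>..\<lfloor>t\<rfloor>}" for z
      unfolding of_int_abs[symmetric] le_floor_iff[symmetric] by auto
    then show ?thesis by (auto simp: PiE_iff)
  qed
  show "finite ?A"
    unfolding eq by (intro finite_PiE) auto
  \<comment> \<open>Absorbing the 1 of 2 \<lfloor>t\<rfloor> + 1 into 3 t makes the count a constant
    times t^m, ready to cancel against the width of the strips.\<close>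
  have "\<lfloor>t\<rfloor> \<ge> 1" using assms by (simp add: le_floor_iff)
  then have "real (nat (2 * \<lfloor>t\<rfloor> + 1)) \<le> 3 * t" using assms by simp linarith
  moreover have "card ?A = nat (2 * \<lfloor>t\<rfloor> + 1) ^ CARD('m)"
    unfolding eq by (simp add: card_PiE)
  ultimately show "card ?A \<le> (3 * t) ^ CARD('m)"
    using power_mono[of "real (nat (2 * \<lfloor>t\<rfloor> + 1))" "3 * t" "CARD('m)"] by (simp only: of_nat_power)
qed

section \<open>The null set of singular completions\<close>

theorem theorem7p6:
  fixes \<theta> :: "real ^ 2"
    and m :: nat
    and C\<^sub>2 :: real
    and N :: "real ^ (2 + 'n::finite) \<Rightarrow> real"
  assumes "m > 2"
    and "CARD('n) = m - 2"
    and "is_norm N"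
    and "C\<^sub>2 > 0"
    and "\<not> bdd_above {t :: real. t \<ge> 1 \<and> C\<^sub>2 \<le> irrationality_measure_fn \<theta> t * t ^ m}"
  shows "AE \<eta> :: real ^ 'n in lebesgue. \<not> singular_vec N (vec_append \<theta> \<eta>)"
proof -
  have m: "CARD(2 + 'n) = m"
    using assms(1,2) by simp
  \<comment> \<open>The given unbounded set yields a sequence tending to infinity, along which
    statements valid for all large \<open>t\<close> apply.\<close>
  have "\<exists>t. real k \<le> t \<and> 1 \<le> t \<and> C\<^sub>2 \<le> irrationality_measure_fn \<theta> t * t ^ m" for k
  proof -
    obtain t where "1 \<le> t" "C\<^sub>2 \<le> irrationality_measure_fn \<theta> t * t ^ m" "\<not> t \<le> real k"
      using assms(5) unfolding bdd_above_def by blast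
    then show ?thesis by (intro exI[of _ t]) auto
  qed
  then obtain t where t: "\<And>k. real k \<le> t k" "\<And>k. 1 \<le> t k"
    "\<And>k. C\<^sub>2 \<le> irrationality_measure_fn \<theta> (t k) * t k ^ m"
    by metis
  have t_lim: "filterlim t at_top sequentially"
    by (rule filterlim_at_top_mono[OF filterlim_real_sequentially]) (use t in auto)
  define S where "S = {\<eta> :: real ^ 'n. singular_vec N (vec_append \<theta> \<eta>)}"
  have negl: "negligible (S \<inter> cbox (vec (- real R)) (vec (real R)))" for R :: nat
  proof (rule negligible_liminf)
    fix e :: real
    assume "e > 0"
    \<comment> \<open>At most (3t)^m forms each contribute 4 (\<epsilon> / t^m) (2R + 2)^n with n =
      \<open>CARD('n)\<close>; the powers of t cancel and the total is \<epsilon> D.\<close>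
    define D where "D = 4 * 3 ^ m * (2 * real R + 2) ^ CARD('n)"
    have "D > 0" by (simp add: D_def)
    \<comment> \<open>The bound 1/4 is what the strip estimate asks for, \<open>C\<^sub>2\<close>
      excludes forms in \<theta> alone, and e / D controls the total measure.\<close>
    define \<epsilon> where "\<epsilon> = Min {1/4, C\<^sub>2, e / D}"
    have \<epsilon>_le: "\<epsilon> \<le> x" if "x \<in> {1/4, C\<^sub>2, e / D}" for x
      unfolding \<epsilon>_def using that by (intro Min_le) auto
    have "\<epsilon> > 0"
      using \<open>e > 0\<close> \<open>D > 0\<close> assms(4) by (simp add: \<epsilon>_def)
    then have \<epsilon>: "\<epsilon> > 0" "\<epsilon> \<le> 1/4" "\<epsilon> \<le> C\<^sub>2" "\<epsilon> \<le> e / D"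
      using \<epsilon>_le[of "1/4"] \<epsilon>_le[of C\<^sub>2] \<epsilon>_le[of "e / D"] by auto
    define E where "E k a = {\<eta> \<in> cbox (vec (- real R)) (vec (real R)) :: (real ^ 'n) set.
      dist_nearest_int ((\<Sum>i\<in>UNIV. a (Inl i) * \<theta> $ i) + (\<Sum>i\<in>UNIV. a (Inr i) * \<eta> $ i)) < \<epsilon> / t k ^ m}"
      for k and a :: "2 + 'n \<Rightarrow> int"
    define I where "I k = {a :: 2 + 'n \<Rightarrow> int. \<forall>i. \<bar>a i\<bar> \<le> t k}" for k
    \<comment> \<open>These are the forms that vary with \<eta>, so the strip estimate applies to
      each of them.\<close>
    define J where "J k = {a \<in> I k. \<exists>j. a (Inr j) \<noteq> 0}" for k
    define B where "B k = (\<Union>a\<in>J k. E k a)" for k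
    have finI: "finite (I k)" and cardI: "real (card (I k)) \<le> (3 * t k) ^ m" for k
      unfolding I_def using card_int_functions_bounded_by[OF t(2), where 'm = "2 + 'n"] unfolding m by auto
    have finJ: "finite (J k)" and cardJ: "card (J k) \<le> (3 * t k) ^ m" for k
    proof -
      have "J k \<subseteq> I k" by (auto simp: J_def)
      then show "finite (J k)" "card (J k) \<le> (3 * t k) ^ m"
        using finI cardI[of k] card_mono[OF finI, of "J k" k] by (auto intro: finite_subset)
    qed
    have tm: "1 \<le> t k ^ m" for k using t(2) by (simp add: one_le_power)
    have \<delta>: "0 < \<epsilon> / t k ^ m" "\<epsilon> / t k ^ m \<le> 1/4" for k
    proof -
      show "0 < \<epsilon> / t k ^ m" using \<epsilon> tm[of k] by (intro divide_pos_pos) auto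
      have "\<epsilon> / t k ^ m \<le> \<epsilon> / 1" using \<epsilon> tm[of k] by (intro divide_left_mono) auto
      then show "\<epsilon> / t k ^ m \<le> 1/4" using \<epsilon>(2) by linarith
    qed
    have E: "E k a \<in> lmeasurable" 
      "measure lebesgue (E k a) \<le> 4 * (\<epsilon> / t k ^ m) * (2 * real R + 2) ^ CARD('n)"
      if aJ: "a \<in> J k" for k a
    proof -
      obtain j where "a (Inr j) \<noteq> 0" using aJ by (auto simp: J_def)
      from measure_linear_form_near_int[of "\<lambda>i. a (Inr i)", OF this \<delta>, of "real R"]
      show "E k a \<in> lmeasurable" 
        "measure lebesgue (E k a) \<le> 4 * (\<epsilon> / t k ^ m) * (2 * real R + 2) ^ CARD('n)"
        unfolding E_def by auto
    qed
    have "B k \<in> lmeasurable \<and> measure lebesgue (B k) \<le> e" for k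
    proof
      show "B k \<in> lmeasurable"
        unfolding B_def using finJ E by (intro fmeasurable.finite_UN) auto
      have "measure lebesgue (B k) \<le> (\<Sum>a\<in>J k. measure lebesgue (E k a))"
        unfolding B_def using finJ E by (intro measure_UNION_le) auto
      also have "\<dots> \<le> (\<Sum>a\<in>J k. 4 * (\<epsilon> / t k ^ m) * (2 * real R + 2) ^ CARD('n))"
        using E by (intro sum_mono) auto
      also have "\<dots> = card (J k) * (4 * (\<epsilon> / t k ^ m) * (2 * real R + 2) ^ CARD('n))"
        by simp
      also have "\<dots> \<le> (3 * t k) ^ m * (4 * (\<epsilon> / t k ^ m) * (2 * real R + 2) ^ CARD('n))"
        using cardJ \<delta>[of k] by (intro mult_right_mono mult_nonneg_nonneg) auto
      also have "\<dots> = \<epsilon> * D"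
        using tm[of k] t(2)[of k] by (simp add: D_def power_mult_distrib field_simps)
      also have "\<dots> \<le> e" using \<epsilon>(4) \<open>D > 0\<close> by (simp add: field_simps)
      finally show "measure lebesgue (B k) \<le> e" .
    qed
    moreover have "\<forall>\<^sub>F k in sequentially. \<eta> \<in> B k"
      if \<eta>: "\<eta> \<in> S \<inter> cbox (vec (- real R)) (vec (real R))" for \<eta>
    proof -
      have "singular_vec N (vec_append \<theta> \<eta>)" using \<eta> by (simp add: S_def)
      from eventually_compose_filterlim[OF singular_vec_imp_dual_small[OF assms(3) this \<epsilon>(1)] t_lim]
      show ?thesis
      proof eventually_elim
        case (elim k)
        then obtain a :: "2 + 'n \<Rightarrow> int" where a: "\<exists>i. a i \<noteq> 0" "\<And>i. \<bar>a i\<bar> \<le> t k"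
          "dist_nearest_int (\<Sum>i\<in>UNIV. a i * vec_append \<theta> \<eta> $ i) < \<epsilon> / t k ^ m"
          unfolding m by auto
        have less: "dist_nearest_int ((\<Sum>i\<in>UNIV. a (Inl i) * \<theta> $ i) + (\<Sum>i\<in>UNIV. a (Inr i) * \<eta> $ i)) < \<epsilon> / t k ^ m"
          using a(3) by (simp add: sum_vec_append)
        \<comment> \<open>Otherwise the form involves \<theta> alone, so \<Psi>(t k) < \<epsilon> /
          (t k)^m, against \<open>C\<^sub>2\<close> \<le> \<Psi>(t k) (t k)^m and \<epsilon> \<le>
          \<open>C\<^sub>2\<close>.\<close>
        have "\<exists>j. a (Inr j) \<noteq> 0"
        proof (rule ccontr)
          assume "\<nexists>j. a (Inr j) \<noteq> 0"
          then have zero: "a (Inr j) = 0" for j by simp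
          then have "\<exists>i. a (Inl i) \<noteq> 0" using a(1) by (metis sum.exhaust)
          from irrationality_measure_fn_le[of "\<lambda>i. a (Inl i)", OF this a(2)]
          have "irrationality_measure_fn \<theta> (t k) \<le> dist_nearest_int (\<Sum>i\<in>UNIV. a (Inl i) * \<theta> $ i)" .
          also have "\<dots> < \<epsilon> / t k ^ m"
            using less by (simp add: zero)
          finally have "irrationality_measure_fn \<theta> (t k) < \<epsilon> / t k ^ m" .
          then have "irrationality_measure_fn \<theta> (t k) * t k ^ m < \<epsilon>"
            using tm[of k] by (simp add: field_simps)
          with t(3)[of k] \<epsilon>(3) show False by simp
        qed
        then show "\<eta> \<in> B k"
          using a(2) less \<eta> by (auto simp: B_def E_def J_def I_def)
      qed
    qed
    ultimately show "\<exists>B. (\<forall>k. B k \<in> lmeasurable \<and> measure lebesgue (B k) \<le> e) \<and>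
      (\<forall>\<eta>\<in>S \<inter> cbox (vec (- real R)) (vec (real R)). \<forall>\<^sub>F k in sequentially. \<eta> \<in> B k)"
      by blast
  qed
  \<comment> \<open>The cubes of integer half-width exhaust the space, so countably many null pieces
    cover \<open>S\<close>.\<close>
  have "S \<subseteq> (\<Union>R::nat. S \<inter> cbox (vec (- real R)) (vec (real R)))"
  proof
    fix \<eta> assume "\<eta> \<in> S"
    obtain R :: nat where "norm \<eta> \<le> R" using real_arch_simple by blast
    then have "\<bar>\<eta> $ i\<bar> \<le> R" for i
      using component_le_norm_cart order_trans by blast
    then have "\<eta> \<in> cbox (vec (- real R)) (vec (real R))"
      by (auto simp: mem_box_cart abs_le_iff minus_le_iff)
    with \<open>\<eta> \<in> S\<close> show "\<eta> \<in> (\<Union>R::nat. S \<inter> cbox (vec (- real R)) (vec (real R)))" by blast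
  qed
  moreover have "negligible (\<Union>R::nat. S \<inter> cbox (vec (- real R)) (vec (real R)))"
    using negl by (intro negligible_countable_Union) auto
  ultimately have "negligible S" by (rule negligible_subset[rotated])
  then show ?thesis
    unfolding negligible_iff_null_sets by (rule AE_I') (auto simp: S_def)
qed

end
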